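(* Let $A$ be a rectified first-order formula, let $F$ be the outer Skolemized form of $A$, and let $n$ be a positive natural number. If $A$ has Property C of order $n$, then we can construct a derivation of $A$ of the following form, in which we read any term starting with a Skolem function as an atomic variable: Step 1: We start with the sentential tautology $F^{\mathcal T_n(F)}$ (or else with some sub-expansion of $F$ with respect to $\mathcal T_n(F)$ that is a sentential tautology). Step 2: Then we may repeatedly apply the generalized rules of $\gamma$-quantification and $\delta^-$-quantification. Step 3: Then we may repeatedly apply the generalized rule of $\gamma$-simplification. Step 4: Then we rename all bound $\delta$-variables to obtain $A$.
   Context: Formulas are formulas of first-order logic without equality with sentential connectives $\neg,\vee,\wedge$ and quantifiers $\forall,\exists$. A formula is rectified if it contains no vacuous quantifier, no variable has both free and bound occurrences in it, and no two quantifiers bind occurrences of the same variable. A quantifier occurrence is a $\gamma$-quantifier if it is existential in the scope of an even number of negation symbols, or universal in the scope of an odd number of negation symbols; otherwise it is a $\delta$-quantifier. Bound $\delta$-variables are the variables bound by $\delta$-quantifiers. A quantifier is accessible in a formula if it is in the scope of no quantifier of that formula. Sentential tautology: a first-order formula that is quantifier-free and truth-functionally valid, its atomic subformulas being read as atomic sentential variables. Height: $|f(t_1,\ldots,t_m)| = 1+\max\{0,|t_1|,\ldots,|t_m|\}$; constants are nullary function symbols, and free variables are treated like constants (so both have height $1$). For a positive natural number $n$ and a formula $F$, $\mathcal T_n(F)$ is the set of terms $t$ with $|t|<n$ built from the function symbols, constants and free variables occurring free in $F$; if neither constants nor free variables occur in $F$, a fresh constant $\bullet$ is added. So $\mathcal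 T_1(F)=\emptyset$. Sub-expansion: let $\mathcal T$ be a finite set of terms and $A$ a rectified formula whose bound variables do not occur in $\mathcal T$. A formula $B$ is a sub-expansion of $A$ w.r.t. $\mathcal T$ according to the following recursion: if $A$ is quantifier-free, $B=A$; if $A=\neg A'$, then $B=\neg B'$ with $B'$ a sub-expansion of $A'$; if $A=A_1'\circ A_2'$ with $\circ\in\{\vee,\wedge\}$, then $B=B_1'\circ B_2'$ with $B_i'$ a sub-expansion of $A_i'$; if $A=\exists x.A'$, then $B=\bigvee_{t\in\mathcal T'}B'\{x\mapsto t\}$ with $B'$ a sub-expansion of $A'$ and $\emptyset\neq\mathcal T'\subseteq\mathcal T$; if $A=\forall x.A'$, then $B=\bigwedge_{t\in\mathcal T'}B'\{x\mapsto t\}$ with $B'$ a sub-expansion of $A'$ and $\emptyset\neq\mathcal T'\subseteq\mathcal T$ (all sub-expansions w.r.t. $\mathcal T$). If $\mathcal T'$ is always taken to be $\mathcal T$, then $B$ is the expansion of $A$ w.r.t. $\mathcal T$, written $A^{\mathcal T}$ (so $A^{\emptyset}$ is defined only if $A$ contains no quantifier). Outer Skolemized form of a rectified formula $B$: remove every $\delta$-quantifier and replace its bound variable $y$ with $y^\delta(x_1,\ldots,x_m)$, where $y^\delta$ is a fresh (Skolem) symbol (the Skolem functions) and $x_1,\ldots,x_m$, in this order, are exactly the variables of the $\gamma$-quantifiers in whose scope the $\delta$-quantifier occurs. Property C of order $n$: a rectified formula $A$ has it iff $F^{\mathcal T_n(F)}$ is (defined and) a sentential tautology, where $F$ is the outer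 Skolemized form of $A$. Inference rules (from premise to conclusion; $A[\ldots]$ is a formula context, $Q\in\{\forall,\exists\}$): - Generalized rule of $\gamma$-quantification: from $A[H\{x\mapsto t\}]$ infer $A[Qx.H]$, where $Qx.$ is an accessible $\gamma$-quantifier of $A[Qx.H]$, $t$ is a term, and the free variables of $t$ must not be bound by quantifiers in $H$ (here $H\{x\mapsto t\}$ replaces all occurrences of $x$ in $H$ with $t$ without renaming; an implicit renaming of bound variables in $H$ is admitted to satisfy the side condition). - Generalized rule of $\delta^-$-quantification: from $A[H]$ infer $A[Qy.H]$, where $Qy.$ is an accessible $\delta$-quantifier of $A[Qy.H]$ and the variable $y$ must not occur free in the context $A[\ldots]$ (an implicit renaming of the bound $y$ is admitted). - Generalized rule of simplification: from $A[H\circ H']$ infer $A[H]$, where $\circ$ is $\vee$ if $[\ldots]$ is a positive position in $A[\ldots]$ (in the scope of an even number of negation symbols) and $\wedge$ if it is negative, and $H'$ is a variant of $H$ (i.e. $H'$ is $H$ up to renaming of variables bound in $H$). - Generalized rule of $\gamma$-simplification: the sub-rule of the previous one where $H$ has the form $Qy.C$ and $Qy.$ is a $\gamma$-quantifier of $A[Qy.C]$. *)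

theory Defs
  imports Main
begin

section \<open>First-order formulas without equality\<close>

datatype ('f, 'v) trm = Var 'v | Fn 'f "('f, 'v) trm list"

datatype conn = Or | And

datatype quant = Forall | Exists

datatype ('f, 'p, 'v) fm =
    Atom 'p "('f, 'v) trm list"
  | Neg "('f, 'p, 'v) fm"
  | Bin conn "('f, 'p, 'v) fm" "('f, 'p, 'v) fm"
  | Qu quant 'v "('f, 'p, 'v) fm"

primrec fv_trm :: "('f, 'v) trm \<Rightarrow> 'v set" where
  "fv_trm (Var x) = {x}"
| "fv_trm (Fn f ts) = \<Union> (set (map fv_trm ts))"

primrec fv :: "('f, 'p, 'v) fm \<Rightarrow> 'v set" where
  "fv (Atom p ts) = \<Union> (set (map fv_trm ts))"
| "fv (Neg A) = fv A"
| "fv (Bin c A B) = fv A \<union> fv B"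
| "fv (Qu q x A) = fv A - {x}"

text \<open>One list entry for each quantifier occurrence.\<close>

primrec binders :: "('f, 'p, 'v) fm \<Rightarrow> 'v list" where
  "binders (Atom p ts) = []"
| "binders (Neg A) = binders A"
| "binders (Bin c A B) = binders A @ binders B"
| "binders (Qu q x A) = x # binders A"

definition all_vars :: "('f, 'p, 'v) fm \<Rightarrow> 'v set" where
  "all_vars A = fv A \<union> set (binders A)"

primrec no_vacuous :: "('f, 'p, 'v) fm \<Rightarrow> bool" where
  "no_vacuous (Atom p ts) \<longleftrightarrow> True"
| "no_vacuous (Neg A) \<longleftrightarrow> no_vacuous A"
| "no_vacuous (Bin c A B) \<longleftrightarrow> no_vacuous A \<and> no_vacuous B"
| "no_vacuous (Qu q x A) \<longleftrightarrow> x \<in> fv A \<and> no_vacuous A"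

definition rectified :: "('f, 'p, 'v) fm \<Rightarrow> bool" where
  "rectified A \<longleftrightarrow> no_vacuous A \<and> fv A \<inter> set (binders A) = {} \<and> distinct (binders A)"

text \<open>The substitution replaces the free occurrences of \<open>x\<close> and never renames a bound variable, so
  it may capture; wherever it is used below, a side condition or rectification excludes this.\<close>

primrec subst_trm :: "'v \<Rightarrow> ('f, 'v) trm \<Rightarrow> ('f, 'v) trm \<Rightarrow> ('f, 'v) trm" where
  "subst_trm x t (Var y) = (if y = x then t else Var y)"
| "subst_trm x t (Fn f ts) = Fn f (map (subst_trm x t) ts)"

primrec subst :: "'v \<Rightarrow> ('f, 'v) trm \<Rightarrow> ('f, 'p, 'v) fm \<Rightarrow> ('f, 'p, 'v) fm" where
  "subst x t (Atom p ts) = Atom p (map (subst_trm x t) ts)"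
| "subst x t (Neg A) = Neg (subst x t A)"
| "subst x t (Bin c A B) = Bin c (subst x t A) (subst x t B)"
| "subst x t (Qu q y A) = Qu q y (if y = x then A else subst x t A)"


section \<open>Sentential tautologies\<close>

definition quantifier_free :: "('f, 'p, 'v) fm \<Rightarrow> bool" where
  "quantifier_free A \<longleftrightarrow> binders A = []"

primrec (nonexhaustive) truth :: "('p \<Rightarrow> ('f, 'v) trm list \<Rightarrow> bool) \<Rightarrow> ('f, 'p, 'v) fm \<Rightarrow> bool" where
  "truth I (Atom p ts) \<longleftrightarrow> I p ts"
| "truth I (Neg A) \<longleftrightarrow> \<not> truth I A"
| "truth I (Bin c A B) \<longleftrightarrow>
     (case c of Or \<Rightarrow> truth I A \<or> truth I B | And \<Rightarrow> truth I A \<and> truth I B)"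

definition sentential_tautology :: "('f, 'p, 'v) fm \<Rightarrow> bool" where
  "sentential_tautology A \<longleftrightarrow> quantifier_free A \<and> (\<forall>I. truth I A)"


section \<open>Outer Skolemized form\<close>

text \<open>\<open>Sk y\<close> is the Skolem symbol \<open>y\<^sup>\<delta>\<close> and \<open>Bullet\<close> the extra constant; having
  constructors of their own makes them fresh for every formula over \<open>'f\<close>.\<close>

datatype ('f, 'v) fsym = Fun 'f | Sk 'v | Bullet

text \<open>The flag \<open>pos\<close> is \<open>True\<close> iff the number of enclosing negations is even.\<close>

definition is_gamma :: "bool \<Rightarrow> quant \<Rightarrow> bool" where
  "is_gamma pos q \<longleftrightarrow> q = (if pos then Exists else Forall)"

text \<open>\<open>xs\<close> lists the variables of the enclosing \<open>\<gamma>\<close>-quantifiers, outermost first.\<close>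

primrec skolemize ::
  "bool \<Rightarrow> 'v list \<Rightarrow> (('f, 'v) fsym, 'p, 'v) fm \<Rightarrow> (('f, 'v) fsym, 'p, 'v) fm" where
  "skolemize pos xs (Atom p ts) = Atom p ts"
| "skolemize pos xs (Neg A) = Neg (skolemize (\<not> pos) xs A)"
| "skolemize pos xs (Bin c A B) = Bin c (skolemize pos xs A) (skolemize pos xs B)"
| "skolemize pos xs (Qu q x A) =
     (if is_gamma pos q then Qu q x (skolemize pos (xs @ [x]) A)
      else subst x (Fn (Sk x) (map Var xs)) (skolemize pos xs A))"

definition outer_skolemized :: "('f, 'p, 'v) fm \<Rightarrow> (('f, 'v) fsym, 'p, 'v) fm" where
  "outer_skolemized A = skolemize True [] (map_fm Fun id id A)"


section \<open>Expansion and Property C\<close>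

primrec height :: "('f, 'v) trm \<Rightarrow> nat" where
  "height (Var x) = 1"
| "height (Fn f ts) = 1 + Max (insert 0 (set (map height ts)))"

text \<open>Terms carry no arity discipline, so function symbols are identified by name and arity;
  constants are the symbols of arity \<open>0\<close>.\<close>

primrec funs_trm :: "('f, 'v) trm \<Rightarrow> ('f \<times> nat) set" where
  "funs_trm (Var x) = {}"
| "funs_trm (Fn f ts) = insert (f, length ts) (\<Union> (set (map funs_trm ts)))"

primrec funs :: "('f, 'p, 'v) fm \<Rightarrow> ('f \<times> nat) set" where
  "funs (Atom p ts) = \<Union> (set (map funs_trm ts))"
| "funs (Neg A) = funs A"
| "funs (Bin c A B) = funs A \<union> funs B"
| "funs (Qu q x A) = funs A"

definition terms_below ::
  "nat \<Rightarrow> (('f, 'v) fsym, 'p, 'v) fm \<Rightarrow> (('f, 'v) fsym, 'v) trm set" where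
  "terms_below n F =
     {t. height t < n \<and> fv_trm t \<subseteq> fv F \<and>
         funs_trm t \<subseteq> funs F \<union>
           (if fv F = {} \<and> (\<forall>c. (c, 0) \<notin> funs F) then {(Bullet, 0)} else {})}"

primrec conn_of :: "quant \<Rightarrow> conn" where
  "conn_of Exists = Or"
| "conn_of Forall = And"

fun big :: "conn \<Rightarrow> ('f, 'p, 'v) fm list \<Rightarrow> ('f, 'p, 'v) fm" where
  "big c [A] = A"
| "big c (A # As) = Bin c A (big c As)"

text \<open>The order of the members of a big disjunction or conjunction over a set of terms is
  immaterial: every enumeration of the set is admitted in a sub-expansion.\<close>

inductive sub_expansion ::
  "('f, 'v) trm set \<Rightarrow> ('f, 'p, 'v) fm \<Rightarrow> ('f, 'p, 'v) fm \<Rightarrow> bool" for T where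
  "quantifier_free A \<Longrightarrow> sub_expansion T A A"
| "sub_expansion T A B \<Longrightarrow> sub_expansion T (Neg A) (Neg B)"
| "sub_expansion T A1 B1 \<Longrightarrow> sub_expansion T A2 B2 \<Longrightarrow>
     sub_expansion T (Bin c A1 A2) (Bin c B1 B2)"
| "sub_expansion T A B \<Longrightarrow> distinct ts \<Longrightarrow> set ts \<noteq> {} \<Longrightarrow> set ts \<subseteq> T \<Longrightarrow>
     sub_expansion T (Qu q x A) (big (conn_of q) (map (\<lambda>t. subst x t B) ts))"

text \<open>For the expansion, one enumeration of the finite set \<open>T\<close> is fixed.\<close>

definition enumeration :: "'a set \<Rightarrow> 'a list" where
  "enumeration T = (SOME ts. distinct ts \<and> set ts = T)"

primrec expansion :: "('f, 'v) trm set \<Rightarrow> ('f, 'p, 'v) fm \<Rightarrow> ('f, 'p, 'v) fm" where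
  "expansion T (Atom p ts) = Atom p ts"
| "expansion T (Neg A) = Neg (expansion T A)"
| "expansion T (Bin c A B) = Bin c (expansion T A) (expansion T B)"
| "expansion T (Qu q x A) =
     big (conn_of q) (map (\<lambda>t. subst x t (expansion T A)) (enumeration T))"

definition expansion_defined :: "('f, 'v) trm set \<Rightarrow> ('f, 'p, 'v) fm \<Rightarrow> bool" where
  "expansion_defined T A \<longleftrightarrow> T \<noteq> {} \<or> quantifier_free A"

definition property_C :: "nat \<Rightarrow> ('f, 'p, 'v) fm \<Rightarrow> bool" where
  "property_C n A \<longleftrightarrow>
     (let F = outer_skolemized A; T = terms_below n F
      in expansion_defined T F \<and> sentential_tautology (expansion T F))"


section \<open>Inference rules\<close>

datatype ('f, 'p, 'v) ctxt =
    Hole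
  | CNeg "('f, 'p, 'v) ctxt"
  | CBinL conn "('f, 'p, 'v) ctxt" "('f, 'p, 'v) fm"
  | CBinR conn "('f, 'p, 'v) fm" "('f, 'p, 'v) ctxt"
  | CQu quant 'v "('f, 'p, 'v) ctxt"

primrec plug :: "('f, 'p, 'v) ctxt \<Rightarrow> ('f, 'p, 'v) fm \<Rightarrow> ('f, 'p, 'v) fm" where
  "plug Hole H = H"
| "plug (CNeg C) H = Neg (plug C H)"
| "plug (CBinL c C B) H = Bin c (plug C H) B"
| "plug (CBinR c A C) H = Bin c A (plug C H)"
| "plug (CQu q x C) H = Qu q x (plug C H)"

primrec positive :: "('f, 'p, 'v) ctxt \<Rightarrow> bool" where
  "positive Hole \<longleftrightarrow> True"
| "positive (CNeg C) \<longleftrightarrow> \<not> positive C"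
| "positive (CBinL c C B) \<longleftrightarrow> positive C"
| "positive (CBinR c A C) \<longleftrightarrow> positive C"
| "positive (CQu q x C) \<longleftrightarrow> positive C"

primrec accessible :: "('f, 'p, 'v) ctxt \<Rightarrow> bool" where
  "accessible Hole \<longleftrightarrow> True"
| "accessible (CNeg C) \<longleftrightarrow> accessible C"
| "accessible (CBinL c C B) \<longleftrightarrow> accessible C"
| "accessible (CBinR c A C) \<longleftrightarrow> accessible C"
| "accessible (CQu q x C) \<longleftrightarrow> False"

primrec fv_ctxt :: "('f, 'p, 'v) ctxt \<Rightarrow> 'v set" where
  "fv_ctxt Hole = {}"
| "fv_ctxt (CNeg C) = fv_ctxt C"
| "fv_ctxt (CBinL c C B) = fv_ctxt C \<union> fv B"
| "fv_ctxt (CBinR c A C) = fv A \<union> fv_ctxt C"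
| "fv_ctxt (CQu q x C) = fv_ctxt C - {x}"

inductive rename_binder :: "('f, 'p, 'v) fm \<Rightarrow> ('f, 'p, 'v) fm \<Rightarrow> bool" where
  "z \<notin> all_vars H \<Longrightarrow> rename_binder (Qu q y H) (Qu q z (subst y (Var z) H))"

inductive rename_step :: "('f, 'p, 'v) fm \<Rightarrow> ('f, 'p, 'v) fm \<Rightarrow> bool" where
  "rename_binder G G' \<Longrightarrow> rename_step (plug C G) (plug C G')"

definition variant :: "('f, 'p, 'v) fm \<Rightarrow> ('f, 'p, 'v) fm \<Rightarrow> bool" where
  "variant = equivclp rename_step"

text \<open>In the following two rules, \<open>variant H H'\<close> and the reflexive closure of \<^const>\<open>rename_binder\<close>
  are the implicit renamings of bound variables.\<close>

inductive gamma_quantification :: "('f, 'p, 'v) fm \<Rightarrow> ('f, 'p, 'v) fm \<Rightarrow> bool" where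
  "accessible C \<Longrightarrow> is_gamma (positive C) q \<Longrightarrow> variant H H' \<Longrightarrow>
   fv_trm t \<inter> set (binders H') = {} \<Longrightarrow>
   gamma_quantification (plug C (subst x t H')) (plug C (Qu q x H))"

inductive delta_minus_quantification :: "('f, 'p, 'v) fm \<Rightarrow> ('f, 'p, 'v) fm \<Rightarrow> bool" where
  "accessible C \<Longrightarrow> \<not> is_gamma (positive C) q \<Longrightarrow> y \<notin> fv_ctxt C \<Longrightarrow>
   rename_binder\<^sup>=\<^sup>= (Qu q y H) G \<Longrightarrow>
   delta_minus_quantification (plug C H) (plug C G)"

inductive simplification ::
  "('f, 'p, 'v) ctxt \<Rightarrow> ('f, 'p, 'v) fm \<Rightarrow> ('f, 'p, 'v) fm \<Rightarrow> ('f, 'p, 'v) fm \<Rightarrow> bool" for C H where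
  "variant H H' \<Longrightarrow>
   simplification C H (plug C (Bin (if positive C then Or else And) H H')) (plug C H)"

inductive gamma_simplification :: "('f, 'p, 'v) fm \<Rightarrow> ('f, 'p, 'v) fm \<Rightarrow> bool" where
  "is_gamma (positive C) q \<Longrightarrow> simplification C (Qu q y H) A B \<Longrightarrow> gamma_simplification A B"

inductive delta_rename_step :: "('f, 'p, 'v) fm \<Rightarrow> ('f, 'p, 'v) fm \<Rightarrow> bool" where
  "\<not> is_gamma (positive C) q \<Longrightarrow> rename_binder (Qu q y H) G \<Longrightarrow>
   delta_rename_step (plug C (Qu q y H)) (plug C G)"


section \<open>Reading Skolem terms as variables\<close>

text \<open>Derivations use an extended supply of variables: \<open>OVar x\<close> is an ordinary variable and
  \<open>SVar y ts\<close> the term \<open>y\<^sup>\<delta>(ts)\<close> read as an atomic variable. In particular, substitution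
  does not affect \<open>ts\<close>.\<close>

datatype ('f, 'v) dvar = OVar 'v | SVar 'v "(('f, 'v) fsym, 'v) trm list"

primrec read_trm ::
  "(('f, 'v) fsym, 'v) trm \<Rightarrow> (('f, 'v) fsym, ('f, 'v) dvar) trm" where
  "read_trm (Var x) = Var (OVar x)"
| "read_trm (Fn g ts) =
     (case g of Sk y \<Rightarrow> Var (SVar y ts) | _ \<Rightarrow> Fn g (map read_trm ts))"

primrec read_fm ::
  "(('f, 'v) fsym, 'p, 'v) fm \<Rightarrow> (('f, 'v) fsym, 'p, ('f, 'v) dvar) fm" where
  "read_fm (Atom p ts) = Atom p (map read_trm ts)"
| "read_fm (Neg A) = Neg (read_fm A)"
| "read_fm (Bin c A B) = Bin c (read_fm A) (read_fm B)"
| "read_fm (Qu q x A) = Qu q (OVar x) (read_fm A)"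

definition derivation_from ::
  "(('f, 'v) fsym, 'p, 'v) fm \<Rightarrow> ('f, 'p, 'v) fm \<Rightarrow> bool" where
  "derivation_from B A \<longleftrightarrow>
     (\<exists>C D. (sup gamma_quantification delta_minus_quantification)\<^sup>*\<^sup>* (read_fm B) C \<and>
            gamma_simplification\<^sup>*\<^sup>* C D \<and>
            delta_rename_step\<^sup>*\<^sup>* D (read_fm (map_fm Fun id id A)))"

end

theory Submission
  imports Defs
begin

text \<open>
  A sub-expansion replaces each \<open>\<gamma>\<close>-quantifier by finitely many instances, and the derivation undoes
  this. Quantifiers are re-introduced from the inside outwards, one at a time, until each big
  disjunction or conjunction is a row of identical quantified formulas; \<open>\<gamma>\<close>-simplification then merges
  every row into a single member. The only difficulty is the eigenvariable condition: the
  \<open>\<delta>\<close>-quantifier of \<open>y\<close> that sits below the instances \<open>ws\<close> of its enclosing \<open>\<gamma>\<close>-quantifiers has the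
  Skolem term \<open>y\<^sup>\<delta>(ws)\<close> as eigenvariable, and this may occur in the instantiating terms at other
  places of the formula.

  Call an occurrence of a quantifier in the expanded formula, together with the terms chosen along the
  path to it, a node. The nodes are processed by decreasing weight, where \<open>S\<close> denotes the size of
  a list of terms:
  the \<open>\<delta>\<close>-node of \<open>y\<close> below \<open>ws\<close> has weight \<open>2 S(ws) + 1\<close>, and the \<open>\<gamma>\<close>-node that extends a path \<open>us\<close>
  by the term \<open>t\<close> has weight \<open>2 S(us @ [t])\<close>. This order is admissible for two reasons.

  \<^item> Paths grow downwards, so a node never outweighs the nodes below it, and a \<open>\<gamma>\<close>-node is strictly
    lighter than all of them. Equal weights arise only for a \<open>\<delta>\<close>-node below another one with no
    \<open>\<gamma>\<close>-quantifier between them, and the recursion on the formula then takes the inner one first.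

  \<^item> If \<open>y\<^sup>\<delta>(ws)\<close> occurs in a term \<open>t\<close> that instantiates a \<open>\<gamma>\<close>-node, then \<open>S(ws) < size t\<close>, so that
    \<open>\<gamma>\<close>-node is strictly heavier than the \<open>\<delta>\<close>-node and its instance has already been abstracted. As the
    instances of a quantifier are pairwise distinct and bound variables are not shared, no other
    \<open>\<delta>\<close>-node has the same eigenvariable. Hence \<open>y\<^sup>\<delta>(ws)\<close> is not free in the surrounding context when
    its quantifier is introduced.

  The formula \<open>stage L k\<close> is the state in which exactly the nodes of weight at least \<open>k\<close> have been
  introduced, where \<open>L\<close> gives the list of terms chosen for each \<open>\<gamma>\<close>-variable. For large \<open>k\<close>
  it is the given sub-expansion (\<open>stage_eventually_instances\<close>), for \<open>k = 0\<close> every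
  quantifier is back (\<open>stage_eq_copies\<close>), and \<open>stage_step\<close> leads from \<open>k + 1\<close> to \<open>k\<close>.
  Each \<open>\<delta>\<^sup>-\<close>-inference renames its eigenvariable to the original bound variable at once, by the implicit
  renaming of the rule; so the merged formula is already \<open>A\<close>, and the sequence of renamings that ends
  the derivation can be empty.
\<close>

section \<open>Instantiation of terms and big connectives\<close>

text \<open>Simultaneous substitution into terms of the original language. It targets both the Skolem
  language (variables \<open>'v\<close>) and its reading with Skolem terms as variables, hence the type
  parameters.\<close>

primrec inst :: "('v \<Rightarrow> (('f, 'u) fsym, 'w) trm) \<Rightarrow> ('f, 'v) trm \<Rightarrow> (('f, 'u) fsym, 'w) trm" where
  "inst \<sigma> (Var x) = \<sigma> x"
| "inst \<sigma> (Fn f ts) = Fn (Fun f) (map (inst \<sigma>) ts)"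

lemma inst_cong: "(\<And>v. v \<in> fv_trm t \<Longrightarrow> \<sigma> v = \<tau> v) \<Longrightarrow> inst \<sigma> t = inst \<tau> t"
  by (induction t) auto

lemma subst_trm_inst: "subst_trm x s (inst \<sigma> t) = inst (\<lambda>v. subst_trm x s (\<sigma> v)) t"
  by (induction t) auto

lemma inst_Var: "inst Var t = map_trm Fun id t"
  by (induction t) auto

lemma read_trm_inst: "read_trm (inst \<sigma> t) = inst (\<lambda>v. read_trm (\<sigma> v)) t"
  by (induction t) auto

lemma fv_trm_inst: "fv_trm (inst \<sigma> t) = (\<Union>v\<in>fv_trm t. fv_trm (\<sigma> v))"
  by (induction t) auto

lemma subst_trm_fresh: "x \<notin> fv_trm t \<Longrightarrow> subst_trm x s t = t"
  by (induction t) (auto intro: map_idI)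

lemma comp_fun_upd: "(\<lambda>v. f ((\<sigma>(x := t)) v)) = (\<lambda>v. f (\<sigma> v))(x := f t)"
  by auto

lemma fv_fun_upd:
  "(\<Union>v\<in>V. fv_trm ((\<sigma>(x := t)) v)) \<subseteq> (\<Union>v\<in>V - {x}. fv_trm (\<sigma> v)) \<union> fv_trm t"
  by (force split: if_splits)

lemma big_Cons: "Gs \<noteq> [] \<Longrightarrow> big c (G # Gs) = Bin c G (big c Gs)"
  by (cases Gs) auto

lemma fv_big: "Gs \<noteq> [] \<Longrightarrow> fv (big c Gs) = \<Union> (fv ` set Gs)"
  by (induction Gs rule: list_nonempty_induct) (auto simp: big_Cons)

lemma binders_big: "Gs \<noteq> [] \<Longrightarrow> set (binders (big c Gs)) = (\<Union>G\<in>set Gs. set (binders G))"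
  by (induction Gs rule: list_nonempty_induct) (auto simp: big_Cons)

lemma subst_big: "Gs \<noteq> [] \<Longrightarrow> subst x t (big c Gs) = big c (map (subst x t) Gs)"
  by (induction Gs rule: list_nonempty_induct) (auto simp: big_Cons)

lemma read_big: "Gs \<noteq> [] \<Longrightarrow> read_fm (big c Gs) = big c (map read_fm Gs)"
  by (induction Gs rule: list_nonempty_induct) (auto simp: big_Cons)

lemma fv_read_OVar: "OVar z \<in> fv_trm (read_trm t) \<Longrightarrow> z \<in> fv_trm t"
  by (induction t) (auto split: fsym.splits)

text \<open>This strict decrease is what makes the order of the quantifications well-behaved: a Skolem term
  that is visible in \<open>t\<close> is a subterm of \<open>t\<close>.\<close>

lemma fv_read_SVar: "SVar y ws \<in> fv_trm (read_trm t) \<Longrightarrow> size_list size ws < size t"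
proof (induction t)
  case (Fn g ts)
  show ?case
  proof (cases "\<exists>y'. g = Sk y'")
    case True
    then show ?thesis using Fn.prems by auto
  next
    case False
    then obtain t where t: "t \<in> set ts" "SVar y ws \<in> fv_trm (read_trm t)"
      using Fn.prems by (auto split: fsym.splits)
    then have "size_list size ws < size t" using Fn.IH by blast
    moreover have "size t \<le> size_list size ts"
      using t(1) by (simp add: size_list_estimation')
    ultimately show ?thesis by simp
  qed
qed auto

section \<open>Contexts\<close>

primrec comp_ctxt :: "('f, 'p, 'v) ctxt \<Rightarrow> ('f, 'p, 'v) ctxt \<Rightarrow> ('f, 'p, 'v) ctxt" where
  "comp_ctxt Hole D = D"
| "comp_ctxt (CNeg C) D = CNeg (comp_ctxt C D)"
| "comp_ctxt (CBinL c C B) D = CBinL c (comp_ctxt C D) B"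
| "comp_ctxt (CBinR c A C) D = CBinR c A (comp_ctxt C D)"
| "comp_ctxt (CQu q x C) D = CQu q x (comp_ctxt C D)"

lemma plug_comp: "plug (comp_ctxt C D) G = plug C (plug D G)"
  by (induction C) auto

lemma accessible_comp: "accessible (comp_ctxt C D) \<longleftrightarrow> accessible C \<and> accessible D"
  by (induction C) auto

lemma positive_comp: "positive (comp_ctxt C D) \<longleftrightarrow> (positive C = positive D)"
  by (induction C) auto

lemma fv_comp: "accessible C \<Longrightarrow> fv_ctxt (comp_ctxt C D) = fv_ctxt C \<union> fv_ctxt D"
  by (induction C) auto

lemma big_context:
  "\<exists>C. accessible C \<and> positive C \<and> fv_ctxt C = \<Union> (fv ` (set Gs \<union> set Hs)) \<and>
       (\<forall>G. plug C G = big c (Gs @ G # Hs))"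
proof (induction Gs)
  case Nil
  show ?case
  proof (cases "Hs = []")
    case True
    then show ?thesis by (intro exI[of _ Hole]) auto
  next
    case False
    then show ?thesis by (intro exI[of _ "CBinL c Hole (big c Hs)"]) (auto simp: big_Cons fv_big)
  qed
next
  case (Cons B Gs)
  then obtain C where "accessible C" "positive C" "fv_ctxt C = \<Union> (fv ` (set Gs \<union> set Hs))"
    "\<forall>G. plug C G = big c (Gs @ G # Hs)" by blast
  then show ?case by (intro exI[of _ "CBinR c B C"]) (auto simp: big_Cons)
qed

text \<open>Rewriting the members of a row from left to right: while \<open>t\<close> is treated, the members before it
  are already in their new form and those after it still in their old one.\<close>

lemma replace_members:
  assumes "\<And>as t bs. ts = as @ t # bs \<Longrightarrow>
     R\<^sup>*\<^sup>* (plug C (big c (map g as @ f t # map f bs))) (plug C (big c (map g as @ g t # map f bs)))"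
  shows "R\<^sup>*\<^sup>* (plug C (big c (map f ts))) (plug C (big c (map g ts)))"
proof -
  have "R\<^sup>*\<^sup>* (plug C (big c (map f ts))) (plug C (big c (map g as @ map f bs)))"
    if "ts = as @ bs" for as bs
    using that
  proof (induction as arbitrary: bs rule: rev_induct)
    case (snoc t as)
    from snoc.IH[of "t # bs"] snoc.prems assms[of as t bs] show ?case
      by (auto intro: rtranclp_trans)
  qed auto
  from this[of ts "[]"] show ?thesis by simp
qed

section \<open>Skolemization and sub-expansion as substitutions\<close>

text \<open>Outer Skolemization substitutes one Skolem term after the other into formulas that are already
  Skolemized. Carrying all pending substitutions in \<open>\<sigma>\<close> makes it a plain recursion on the formula, so
  that its sub-expansions can be analysed by structural induction on the original formula.\<close>

primrec sk_inst ::
  "bool \<Rightarrow> 'v list \<Rightarrow> ('v \<Rightarrow> (('f, 'v) fsym, 'v) trm) \<Rightarrow> ('f, 'p, 'v) fm \<Rightarrow> (('f, 'v) fsym, 'p, 'v) fm"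
where
  "sk_inst pos xs \<sigma> (Atom p ts) = Atom p (map (inst \<sigma>) ts)"
| "sk_inst pos xs \<sigma> (Neg A) = Neg (sk_inst (\<not> pos) xs \<sigma> A)"
| "sk_inst pos xs \<sigma> (Bin c A B) = Bin c (sk_inst pos xs \<sigma> A) (sk_inst pos xs \<sigma> B)"
| "sk_inst pos xs \<sigma> (Qu q x A) =
     (if is_gamma pos q then Qu q x (sk_inst pos (xs @ [x]) (\<sigma>(x := Var x)) A)
      else sk_inst pos xs (\<sigma>(x := Fn (Sk x) (map Var xs))) A)"

lemma subst_sk_inst:
  "y \<notin> set xs \<Longrightarrow> y \<notin> set (binders A) \<Longrightarrow>
   subst y s (sk_inst pos xs \<sigma> A) = sk_inst pos xs (\<lambda>v. subst_trm y s (\<sigma> v)) A"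
proof (induction A arbitrary: pos xs \<sigma>)
  case (Qu q x A)
  have IH: "subst y s (sk_inst pos ys (\<sigma>(x := t)) A) =
      sk_inst pos ys ((\<lambda>v. subst_trm y s (\<sigma> v))(x := subst_trm y s t)) A" if "y \<notin> set ys" for ys t
    unfolding comp_fun_upd[of "subst_trm y s", symmetric]
    by (rule Qu.IH) (use Qu.prems(2) that in auto)
  have fresh: "subst_trm y s (Fn (Sk x) (map Var xs)) = Fn (Sk x) (map Var xs)"
    using Qu.prems(1) by (intro subst_trm_fresh) auto
  show ?case
    using Qu.prems IH[of "xs @ [x]" "Var x"] IH[of xs "Fn (Sk x) (map Var xs)", unfolded fresh]
    by auto
qed (auto simp: subst_trm_inst)

lemma skolemize_eq_sk_inst:
  "distinct (binders A) \<Longrightarrow> set xs \<inter> set (binders A) = {} \<Longrightarrow>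
   skolemize pos xs (map_fm Fun id id A) = sk_inst pos xs Var A"
proof (induction A arbitrary: pos xs)
  case (Qu q x A)
  let ?s = "Fn (Sk x) (map Var xs)"
  have gamma: "skolemize pos (xs @ [x]) (map_fm Fun id id A) = sk_inst pos (xs @ [x]) Var A"
    using Qu.prems by (intro Qu.IH) auto
  have upd: "(\<lambda>v. subst_trm x ?s (Var v)) = Var(x := ?s)" by auto
  have "subst x ?s (sk_inst pos xs Var A) = sk_inst pos xs (Var(x := ?s)) A"
    unfolding upd[symmetric] by (rule subst_sk_inst) (use Qu.prems in auto)
  moreover have "skolemize pos xs (map_fm Fun id id A) = sk_inst pos xs Var A"
    using Qu.prems by (intro Qu.IH) auto
  ultimately have delta:
    "subst x ?s (skolemize pos xs (map_fm Fun id id A)) = sk_inst pos xs (Var(x := ?s)) A" by simp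
  have "Var(x := Var x) = Var" by (rule fun_upd_triv)
  then show ?case using gamma delta by (simp add: id_def)
qed (auto simp: inst_Var Int_Un_distrib)

lemma fv_sk_inst: "fv (sk_inst pos xs \<sigma> A) \<subseteq> (\<Union>v\<in>fv A. fv_trm (\<sigma> v)) \<union> set xs"
proof (induction A arbitrary: pos xs \<sigma>)
  case (Qu q x A)
  have "fv (sk_inst pos ys (\<sigma>(x := t)) A) \<subseteq> (\<Union>v\<in>fv A - {x}. fv_trm (\<sigma> v)) \<union> fv_trm t \<union> set ys" for ys t
    using Qu[of pos ys "\<sigma>(x := t)"] fv_fun_upd[of \<sigma> x t "fv A"] by blast
  from this[of "xs @ [x]" "Var x"] this[of xs "Fn (Sk x) (map Var xs)"] show ?case by auto
next
  case (Bin c A B)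
  from Bin(1)[of pos xs \<sigma>] Bin(2)[of pos xs \<sigma>] show ?case by auto
qed (auto simp: fv_trm_inst)

text \<open>The sub-expansion in which each \<open>\<gamma>\<close>-variable \<open>x\<close> receives the instances \<open>L x\<close>, with all
  substitutions carried out at the atoms. One list per variable suffices: a sub-expansion expands the
  body of a quantifier before it forms the instances of that body, so all copies share their choices.
  The list \<open>us\<close> is the path, that is, the arguments of the Skolem terms below.\<close>

primrec instances ::
  "('v \<Rightarrow> (('f, 'v) fsym, 'v) trm list) \<Rightarrow> bool \<Rightarrow> (('f, 'v) fsym, 'v) trm list \<Rightarrow>
   ('v \<Rightarrow> (('f, 'v) fsym, 'v) trm) \<Rightarrow> ('f, 'p, 'v) fm \<Rightarrow> (('f, 'v) fsym, 'p, 'v) fm"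
where
  "instances L pos us \<sigma> (Atom p ts) = Atom p (map (inst \<sigma>) ts)"
| "instances L pos us \<sigma> (Neg A) = Neg (instances L (\<not> pos) us \<sigma> A)"
| "instances L pos us \<sigma> (Bin c A B) = Bin c (instances L pos us \<sigma> A) (instances L pos us \<sigma> B)"
| "instances L pos us \<sigma> (Qu q x A) =
     (if is_gamma pos q
      then big (conn_of q) (map (\<lambda>t. instances L pos (us @ [t]) (\<sigma>(x := t)) A) (L x))
      else instances L pos us (\<sigma>(x := Fn (Sk x) us)) A)"

lemma instances_cong:
  "(\<And>v. v \<in> fv A \<Longrightarrow> \<sigma> v = \<tau> v) \<Longrightarrow> (\<And>z. z \<in> set (binders A) \<Longrightarrow> L z = M z) \<Longrightarrow>
   instances L pos us \<sigma> A = instances M pos us \<tau> A"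
proof (induction A arbitrary: pos us \<sigma> \<tau>)
  case (Atom p ts)
  then show ?case by (auto intro!: inst_cong)
next
  case (Neg A)
  show ?case using Neg.IH[of \<sigma> \<tau>] Neg.prems by simp
next
  case (Bin c A B)
  show ?case using Bin.IH(1)[of \<sigma> \<tau>] Bin.IH(2)[of \<sigma> \<tau>] Bin.prems by simp
next
  case (Qu q x A)
  have "instances L pos us' (\<sigma>(x := t)) A = instances M pos us' (\<tau>(x := t)) A" for us' t
    by (rule Qu.IH) (use Qu.prems in auto)
  then show ?case using Qu.prems(2)[of x] by simp
qed

text \<open>The conditions are imposed on all variables, not only on the \<open>\<gamma>\<close>-variables of a given formula;
  then choices for two subformulas can be merged, and the singleton list of \<open>Bullet\<close> serves as
  default.\<close>

definition admissible :: "'v set \<Rightarrow> ('v \<Rightarrow> (('f, 'v) fsym, 'v) trm list) \<Rightarrow> bool" where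
  "admissible X L \<longleftrightarrow>
     (\<forall>z. L z \<noteq> [] \<and> distinct (L z) \<and> (\<forall>t\<in>set (L z). fv_trm t \<inter> X = {}))"

lemma subst_instances:
  assumes "admissible X L" "x \<in> X" "x \<notin> set (binders A)"
  shows "subst x s (instances L pos us \<sigma> A) =
    instances L pos (map (subst_trm x s) us) (\<lambda>v. subst_trm x s (\<sigma> v)) A"
  using assms(3)
proof (induction A arbitrary: pos us \<sigma>)
  case (Qu q z A)
  have ne: "L z \<noteq> []" using assms(1) by (auto simp: admissible_def)
  have fresh: "subst_trm x s t = t" if "t \<in> set (L z)" for t
    using assms(1,2) that by (intro subst_trm_fresh) (auto simp: admissible_def)
  have IH: "subst x s (instances L pos vs (\<sigma>(z := t)) A) = instances L pos (map (subst_trm x s) vs)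
      ((\<lambda>v. subst_trm x s (\<sigma> v))(z := subst_trm x s t)) A" for vs t
    unfolding comp_fun_upd[of "subst_trm x s", symmetric]
    by (rule Qu.IH) (use Qu.prems in auto)
  show ?case using Qu.prems ne by (auto simp: subst_big IH fresh cong: map_cong)
qed (auto simp: subst_trm_inst)

lemma sub_expansion_Neg:
  assumes "sub_expansion T (Neg F) B"
  obtains B' where "B = Neg B'" "sub_expansion T F B'"
  using assms sub_expansion.intros(1)[of F T]
  by (cases rule: sub_expansion.cases) (auto simp: quantifier_free_def)

lemma sub_expansion_Bin:
  assumes "sub_expansion T (Bin c F1 F2) B"
  obtains B1 B2 where "B = Bin c B1 B2" "sub_expansion T F1 B1" "sub_expansion T F2 B2"
  using assms sub_expansion.intros(1)[of F1 T] sub_expansion.intros(1)[of F2 T]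
  by (cases rule: sub_expansion.cases) (auto simp: quantifier_free_def)

lemma sub_expansion_Qu:
  assumes "sub_expansion T (Qu q x F) B"
  obtains B' ts where "B = big (conn_of q) (map (\<lambda>t. subst x t B') ts)" "sub_expansion T F B'"
    "distinct ts" "ts \<noteq> []" "set ts \<subseteq> T"
  using assms by (cases rule: sub_expansion.cases) (auto simp: quantifier_free_def)

text \<open>Each sub-expansion of the Skolemized formula arises from a choice \<open>L\<close>. A \<open>\<gamma>\<close>-quantifier first
  appears with its own variable as last element of the path; instantiating it by \<open>t\<close> turns
  this element, and with it all inner Skolem terms, into those for the extended path.\<close>

lemma sub_expansion_instances:
  assumes T: "\<forall>t\<in>T. fv_trm t \<inter> X = {}"
  shows "sub_expansion T (sk_inst pos xs \<sigma> A) B \<Longrightarrow> distinct (binders A) \<Longrightarrow>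
    set (binders A) \<subseteq> X \<Longrightarrow> set xs \<inter> set (binders A) = {} \<Longrightarrow>
    (\<And>v. v \<in> fv A \<Longrightarrow> fv_trm (\<sigma> v) \<inter> set (binders A) = {}) \<Longrightarrow>
    \<exists>L. admissible X L \<and> B = instances L pos (map Var xs) \<sigma> A"
proof (induction A arbitrary: pos xs \<sigma> B)
  case (Atom p ts)
  have "admissible X (\<lambda>_. [Fn Bullet []])" by (simp add: admissible_def)
  moreover have "B = Atom p (map (inst \<sigma>) ts)"
    using Atom.prems(1) by (auto elim: sub_expansion.cases)
  ultimately show ?case by auto
next
  case (Neg A)
  from Neg.prems(1) obtain B' where "B = Neg B'" "sub_expansion T (sk_inst (\<not> pos) xs \<sigma> A) B'"
    by (auto elim: sub_expansion_Neg)
  with Neg.IH[of "\<not> pos" xs \<sigma> B'] Neg.prems(2-) show ?case by auto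
next
  case (Bin c A1 A2)
  from Bin.prems(1) obtain B1 B2 where B: "B = Bin c B1 B2"
    and B1: "sub_expansion T (sk_inst pos xs \<sigma> A1) B1"
    and B2: "sub_expansion T (sk_inst pos xs \<sigma> A2) B2"
    by (auto elim: sub_expansion_Bin)
  have "\<exists>L. admissible X L \<and> B1 = instances L pos (map Var xs) \<sigma> A1"
    using Bin.prems(2-) by (intro Bin.IH(1)[OF B1]) auto
  then obtain L1 where L1: "admissible X L1" "B1 = instances L1 pos (map Var xs) \<sigma> A1" by blast
  have "\<exists>L. admissible X L \<and> B2 = instances L pos (map Var xs) \<sigma> A2"
    using Bin.prems(2-) by (intro Bin.IH(2)[OF B2]) auto
  then obtain L2 where L2: "admissible X L2" "B2 = instances L2 pos (map Var xs) \<sigma> A2" by blast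
  let ?L = "\<lambda>z. if z \<in> set (binders A1) then L1 z else L2 z"
  have "admissible X ?L" using L1(1) L2(1) by (auto simp: admissible_def)
  moreover have "B1 = instances ?L pos (map Var xs) \<sigma> A1"
    unfolding L1(2) by (rule instances_cong) auto
  moreover have "B2 = instances ?L pos (map Var xs) \<sigma> A2"
    unfolding L2(2) using Bin.prems(2) by (intro instances_cong) auto
  ultimately show ?case using B by (intro exI[of _ ?L]) auto
next
  case (Qu q x A)
  show ?case
  proof (cases "is_gamma pos q")
    case True
    from Qu.prems(1) True obtain B' ts where
      B: "B = big (conn_of q) (map (\<lambda>t. subst x t B') ts)"
      and B': "sub_expansion T (sk_inst pos (xs @ [x]) (\<sigma>(x := Var x)) A) B'"
      and ts: "distinct ts" "ts \<noteq> []" "set ts \<subseteq> T"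
      by (auto elim: sub_expansion_Qu)
    have "\<exists>L. admissible X L \<and> B' = instances L pos (map Var (xs @ [x])) (\<sigma>(x := Var x)) A"
      using Qu.prems(2-) by (intro Qu.IH[OF B']) (auto split: if_splits)
    then obtain L where L: "admissible X L"
      "B' = instances L pos (map Var (xs @ [x])) (\<sigma>(x := Var x)) A" by blast
    let ?L = "L(x := ts)"
    have adm: "admissible X ?L" using L(1) ts T by (auto simp: admissible_def)
    have "subst x t B' = instances ?L pos (map Var xs @ [t]) (\<sigma>(x := t)) A" for t
    proof -
      have "B' = instances ?L pos (map Var (xs @ [x])) (\<sigma>(x := Var x)) A"
        unfolding L(2) using Qu.prems(2) by (intro instances_cong) auto
      then have "subst x t B' = instances ?L pos (map (subst_trm x t) (map Var (xs @ [x])))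
          (\<lambda>v. subst_trm x t ((\<sigma>(x := Var x)) v)) A"
        using subst_instances[OF adm, of x A] Qu.prems(2,3) by simp
      also have "map (subst_trm x t) (map Var (xs @ [x])) = map Var xs @ [t]"
        using Qu.prems(4) by auto
      also have "instances ?L pos (map Var xs @ [t]) (\<lambda>v. subst_trm x t ((\<sigma>(x := Var x)) v)) A =
          instances ?L pos (map Var xs @ [t]) (\<sigma>(x := t)) A"
        using Qu.prems(5) by (intro instances_cong) (auto intro!: subst_trm_fresh)
      finally show ?thesis .
    qed
    then have "B = instances ?L pos (map Var xs) \<sigma> (Qu q x A)" using B True by simp
    with adm show ?thesis by blast
  next
    case False
    then have "sub_expansion T (sk_inst pos xs (\<sigma>(x := Fn (Sk x) (map Var xs))) A) B"
      using Qu.prems(1) by (simp del: fun_upd_apply)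
    then have "\<exists>L. admissible X L \<and>
        B = instances L pos (map Var xs) (\<sigma>(x := Fn (Sk x) (map Var xs))) A"
      by (rule Qu.IH) (use Qu.prems(2-) in \<open>auto split: if_splits\<close>)
    then show ?thesis using False by (simp del: fun_upd_apply)
  qed
qed

section \<open>Re-introducing quantifiers by decreasing weight\<close>

type_synonym ('f, 'v) dtrm = "(('f, 'v) fsym, ('f, 'v) dvar) trm"

text \<open>The formula with all quantifiers back, each \<open>\<gamma>\<close>-quantified subformula repeated once for each of
  its former instances. The substitution \<open>\<rho>\<close> concerns only the variables that are free in the
  subformula, so the copies in a row are identical.\<close>

primrec copies ::
  "('v \<Rightarrow> (('f, 'v) fsym, 'v) trm list) \<Rightarrow> bool \<Rightarrow> ('v \<Rightarrow> ('f, 'v) dtrm) \<Rightarrow> ('f, 'p, 'v) fm \<Rightarrow>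
   (('f, 'v) fsym, 'p, ('f, 'v) dvar) fm"
where
  "copies L pos \<rho> (Atom p ts) = Atom p (map (inst \<rho>) ts)"
| "copies L pos \<rho> (Neg A) = Neg (copies L (\<not> pos) \<rho> A)"
| "copies L pos \<rho> (Bin c A B) = Bin c (copies L pos \<rho> A) (copies L pos \<rho> B)"
| "copies L pos \<rho> (Qu q x A) =
     (let G = Qu q (OVar x) (copies L pos (\<rho>(x := Var (OVar x))) A)
      in if is_gamma pos q then big (conn_of q) (map (\<lambda>t. G) (L x)) else G)"

text \<open>Once a node is introduced, so is everything below it, because weights do not decrease downwards;
  this is why the introduced case can be expressed by \<^const>\<open>copies\<close>. The substitution \<open>\<rho>\<close> maps the
  variable of a pending quantifier to its instance or to its eigenvariable.\<close>

primrec stage ::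
  "('v \<Rightarrow> (('f, 'v) fsym, 'v) trm list) \<Rightarrow> nat \<Rightarrow> bool \<Rightarrow> (('f, 'v) fsym, 'v) trm list \<Rightarrow>
   ('v \<Rightarrow> ('f, 'v) dtrm) \<Rightarrow> ('f, 'p, 'v) fm \<Rightarrow> (('f, 'v) fsym, 'p, ('f, 'v) dvar) fm"
where
  "stage L k pos us \<rho> (Atom p ts) = Atom p (map (inst \<rho>) ts)"
| "stage L k pos us \<rho> (Neg A) = Neg (stage L k (\<not> pos) us \<rho> A)"
| "stage L k pos us \<rho> (Bin c A B) = Bin c (stage L k pos us \<rho> A) (stage L k pos us \<rho> B)"
| "stage L k pos us \<rho> (Qu q x A) =
     (let G = Qu q (OVar x) (copies L pos (\<rho>(x := Var (OVar x))) A)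
      in if is_gamma pos q
         then big (conn_of q)
           (map (\<lambda>t. if k \<le> 2 * size_list size (us @ [t]) then G
                     else stage L k pos (us @ [t]) (\<rho>(x := read_trm t)) A) (L x))
         else if k \<le> 2 * size_list size us + 1 then G
         else stage L k pos us (\<rho>(x := Var (SVar x us))) A)"

text \<open>Variable and path of each \<open>\<delta>\<close>-node, that is, the symbol and the arguments of its
  eigenvariable.\<close>

primrec delta_nodes ::
  "('v \<Rightarrow> (('f, 'v) fsym, 'v) trm list) \<Rightarrow> bool \<Rightarrow> (('f, 'v) fsym, 'v) trm list \<Rightarrow>
   ('f, 'p, 'v) fm \<Rightarrow> ('v \<times> (('f, 'v) fsym, 'v) trm list) set"
where
  "delta_nodes L pos us (Atom p ts) = {}"
| "delta_nodes L pos us (Neg A) = delta_nodes L (\<not> pos) us A"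
| "delta_nodes L pos us (Bin c A B) = delta_nodes L pos us A \<union> delta_nodes L pos us B"
| "delta_nodes L pos us (Qu q x A) =
     (if is_gamma pos q then \<Union>t\<in>set (L x). delta_nodes L pos (us @ [t]) A
      else insert (x, us) (delta_nodes L pos us A))"

lemma delta_nodes_path:
  "(y, ws) \<in> delta_nodes L pos us A \<Longrightarrow> y \<in> set (binders A) \<and> (\<exists>vs. ws = us @ vs)"
  by (induction A arbitrary: pos us) (fastforce split: if_splits)+

text \<open>The bound is the least weight that a node below the path \<open>us\<close> can have, attained by a \<open>\<delta>\<close>-node
  directly below it.\<close>

lemma stage_eq_copies:
  "k \<le> 2 * size_list size us + 1 \<Longrightarrow> stage L k pos us \<rho> A = copies L pos \<rho> A"
  by (induction A arbitrary: pos us \<rho>) (auto simp: Let_def)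

lemma copies_cong:
  "(\<And>v. v \<in> fv A \<Longrightarrow> \<rho> v = \<tau> v) \<Longrightarrow> copies L pos \<rho> A = copies L pos \<tau> A"
proof (induction A arbitrary: pos \<rho> \<tau>)
  case (Atom p ts)
  then show ?case by (auto intro!: inst_cong)
next
  case (Neg A)
  show ?case using Neg.IH[of \<rho> \<tau>] Neg.prems by simp
next
  case (Bin c A B)
  show ?case using Bin.IH(1)[of \<rho> \<tau>] Bin.IH(2)[of \<rho> \<tau>] Bin.prems by simp
next
  case (Qu q x A)
  have "copies L pos (\<rho>(x := Var (OVar x))) A = copies L pos (\<tau>(x := Var (OVar x))) A"
    by (rule Qu.IH) (use Qu.prems in auto)
  then show ?case by simp
qed

definition quant_step :: "('f, 'p, 'v) fm \<Rightarrow> ('f, 'p, 'v) fm \<Rightarrow> bool" where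
  "quant_step = sup gamma_quantification delta_minus_quantification"

context
  fixes X :: "'v set" and L :: "'v \<Rightarrow> (('f, 'v) fsym, 'v) trm list"
  assumes adm: "admissible X L"
begin

lemma L_nonempty: "L x \<noteq> []" and L_distinct: "distinct (L x)"
  and L_fresh: "t \<in> set (L x) \<Longrightarrow> fv_trm t \<inter> X = {}"
  using adm by (auto simp: admissible_def)

lemma subst_copies:
  "w \<notin> OVar ` set (binders A) \<Longrightarrow>
   subst w s (copies L pos \<rho> A) = copies L pos (\<lambda>v. subst_trm w s (\<rho> v)) A"
proof (induction A arbitrary: pos \<rho>)
  case (Qu q x A)
  have IH: "subst w s (copies L pos (\<rho>(x := t)) A) =
      copies L pos ((\<lambda>v. subst_trm w s (\<rho> v))(x := subst_trm w s t)) A" for t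
    unfolding comp_fun_upd[of "subst_trm w s", symmetric]
    by (rule Qu.IH) (use Qu.prems in auto)
  show ?case using Qu.prems L_nonempty IH[of "Var (OVar x)"] by (auto simp: subst_big Let_def comp_def)
qed (auto simp: subst_trm_inst image_Un)

lemma fv_copies: "fv (copies L pos \<rho> A) \<subseteq> (\<Union>v\<in>fv A. fv_trm (\<rho> v))"
proof (induction A arbitrary: pos \<rho>)
  case (Qu q x A)
  have "fv (copies L pos (\<rho>(x := Var (OVar x))) A) \<subseteq> (\<Union>v\<in>fv A - {x}. fv_trm (\<rho> v)) \<union> {OVar x}"
    by (rule order_trans[OF Qu order_trans[OF fv_fun_upd]]) simp
  then show ?case using L_nonempty[of x] by (auto simp: Let_def fv_big)
next
  case (Bin c A B)
  from Bin(1)[of pos \<rho>] Bin(2)[of pos \<rho>] show ?case by auto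
qed (auto simp: fv_trm_inst)

lemma binders_copies: "set (binders (copies L pos \<rho> A)) \<subseteq> OVar ` set (binders A)"
proof (induction A arbitrary: pos \<rho>)
  case (Qu q x A)
  have "set (binders (copies L pos (\<rho>(x := Var (OVar x))) A)) \<subseteq> OVar ` set (binders A)"
    by (rule Qu)
  then show ?case using L_nonempty[of x] by (auto simp: Let_def binders_big)
next
  case (Bin c A B)
  from Bin(1)[of pos \<rho>] Bin(2)[of pos \<rho>] show ?case by auto
qed auto

text \<open>Abstracting an instance and then substituting it back, or renaming an eigenvariable, only changes
  one value of \<open>\<rho>\<close>.\<close>

lemma subst_copies_upd:
  assumes "w \<notin> OVar ` set (binders A)" "\<And>v. v \<in> fv A - {x} \<Longrightarrow> w \<notin> fv_trm (\<rho> v)"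
  shows "subst w s (copies L pos (\<rho>(x := Var w)) A) = copies L pos (\<rho>(x := s)) A"
  unfolding subst_copies[OF assms(1)]
  using assms(2) by (intro copies_cong) (auto intro!: subst_trm_fresh)

lemma gamma_step:
  assumes "accessible C" "is_gamma (positive C) q"
    and "x \<notin> set (binders A)"
    and "\<And>v. v \<in> fv A - {x} \<Longrightarrow> OVar x \<notin> fv_trm (\<rho> v)"
    and "fv_trm s \<inter> OVar ` set (binders A) = {}"
  shows "quant_step (plug C (copies L pos (\<rho>(x := s)) A))
    (plug C (Qu q (OVar x) (copies L pos (\<rho>(x := Var (OVar x))) A)))"
proof -
  let ?H = "copies L pos (\<rho>(x := Var (OVar x))) A"
  have "variant ?H ?H" by (simp add: variant_def)
  moreover have "fv_trm s \<inter> set (binders ?H) = {}"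
    using assms(5) binders_copies by fast
  ultimately have "gamma_quantification (plug C (subst (OVar x) s ?H)) (plug C (Qu q (OVar x) ?H))"
    using assms(1,2) by (rule gamma_quantification.intros[rotated 2])
  moreover have "subst (OVar x) s ?H = copies L pos (\<rho>(x := s)) A"
    using assms(3,4) by (intro subst_copies_upd) auto
  ultimately show ?thesis by (simp add: quant_step_def)
qed

lemma delta_step:
  assumes "accessible C" "\<not> is_gamma (positive C) q"
    and "SVar x us \<notin> fv_ctxt C"
    and "x \<notin> set (binders A)"
    and "\<And>v. v \<in> fv A - {x} \<Longrightarrow> OVar x \<notin> fv_trm (\<rho> v)"
    and "\<And>v. v \<in> fv A - {x} \<Longrightarrow> SVar x us \<notin> fv_trm (\<rho> v)"
  shows "quant_step (plug C (copies L pos (\<rho>(x := Var (SVar x us))) A))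
    (plug C (Qu q (OVar x) (copies L pos (\<rho>(x := Var (OVar x))) A)))"
proof -
  let ?H = "copies L pos (\<rho>(x := Var (SVar x us))) A"
  have "OVar x \<notin> all_vars ?H"
    using assms(4,5) binders_copies[of pos "\<rho>(x := Var (SVar x us))" A]
      fv_copies[of pos "\<rho>(x := Var (SVar x us))" A]
    by (fastforce simp: all_vars_def split: if_splits)
  then have "rename_binder (Qu q (SVar x us) ?H)
      (Qu q (OVar x) (subst (SVar x us) (Var (OVar x)) ?H))"
    by (rule rename_binder.intros)
  also have "subst (SVar x us) (Var (OVar x)) ?H = copies L pos (\<rho>(x := Var (OVar x))) A"
    using assms(6) by (intro subst_copies_upd) auto
  finally have "delta_minus_quantification (plug C ?H)
      (plug C (Qu q (OVar x) (copies L pos (\<rho>(x := Var (OVar x))) A)))"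
    using assms(1-3) by (intro delta_minus_quantification.intros sup2I1)
  then show ?thesis by (simp add: quant_step_def)
qed

text \<open>The eigenvariable \<open>y\<^sup>\<delta>(ws)\<close> can enter a stage through \<open>\<rho>\<close>, through a \<open>\<delta>\<close>-node of its own, or
  through the term of a \<open>\<gamma>\<close>-node that is still pending. The last is impossible up to stage
  \<open>2 S(ws) + 2\<close>, because such a \<open>\<gamma>\<close>-node has at least that weight. The bound covers both ends
  of the step that introduces the \<open>\<delta>\<close>-node, whose weight is \<open>2 S(ws) + 1\<close>.\<close>

lemma stage_avoids:
  assumes "k \<le> 2 * size_list size ws + 2"
  shows "(\<And>v. v \<in> fv A \<Longrightarrow> SVar y ws \<notin> fv_trm (\<rho> v)) \<Longrightarrow> (y, ws) \<notin> delta_nodes L pos us A \<Longrightarrow>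
    SVar y ws \<notin> fv (stage L k pos us \<rho> A)"
proof (induction A arbitrary: pos us \<rho>)
  case (Atom p ts)
  then show ?case by (auto simp: fv_trm_inst)
next
  case (Qu q x A)
  have closed: "SVar y ws \<notin> fv (Qu q (OVar x) (copies L pos (\<rho>(x := Var (OVar x))) A))"
    using fv_copies[of pos "\<rho>(x := Var (OVar x))" A] Qu.prems(1)
    by (fastforce split: if_splits)
  have gam: "SVar y ws \<notin> fv (stage L k pos (us @ [t]) (\<rho>(x := read_trm t)) A)"
    if "is_gamma pos q" "t \<in> set (L x)" "\<not> k \<le> 2 * size_list size (us @ [t])" for t
  proof (rule Qu.IH)
    have "SVar y ws \<notin> fv_trm (read_trm t)"
      using fv_read_SVar[of y ws t] that(3) assms by auto
    then show "SVar y ws \<notin> fv_trm ((\<rho>(x := read_trm t)) v)" if "v \<in> fv A" for v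
      using Qu.prems(1) that by auto
    show "(y, ws) \<notin> delta_nodes L pos (us @ [t]) A" using Qu.prems(2) that by auto
  qed
  have del: "SVar y ws \<notin> fv (stage L k pos us (\<rho>(x := Var (SVar x us))) A)" if "\<not> is_gamma pos q"
    using Qu.prems that by (intro Qu.IH) auto
  show ?case
    using closed gam del L_nonempty[of x] by (auto simp: Let_def fv_big split: if_splits)
qed auto

text \<open>All nodes of weight \<open>k\<close> are introduced, by recursion on the formula inside an accessible context.
  The last assumptions are the invariants of this recursion: \<open>\<rho>\<close> does not mention variables that are
  bound further inside; an eigenvariable in \<open>\<rho>\<close> whose variable is bound further inside comes from an
  instantiating term on the path and is therefore smaller than the path, which excludes that it is the
  eigenvariable of a node below; and the eigenvariables that are due do not occur in the context. For
  the context they are maintained because siblings are covered by \<open>stage_avoids\<close>.\<close>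

lemma stage_step:
  assumes "accessible C" "positive C = pos" "distinct (binders A)" "set (binders A) \<subseteq> X"
    and "\<And>v z. v \<in> fv A \<Longrightarrow> z \<in> set (binders A) \<Longrightarrow> OVar z \<notin> fv_trm (\<rho> v)"
    and "\<And>v y ws. v \<in> fv A \<Longrightarrow> y \<in> set (binders A) \<Longrightarrow> SVar y ws \<in> fv_trm (\<rho> v) \<Longrightarrow>
      size_list size ws < size_list size us"
    and "\<And>y ws. (y, ws) \<in> delta_nodes L pos us A \<Longrightarrow> k = 2 * size_list size ws + 1 \<Longrightarrow>
      SVar y ws \<notin> fv_ctxt C"
  shows "quant_step\<^sup>*\<^sup>* (plug C (stage L (Suc k) pos us \<rho> A)) (plug C (stage L k pos us \<rho> A))"
  using assms
proof (induction A arbitrary: C pos us \<rho>)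
  case (Atom p ts)
  then show ?case by simp
next
  case (Neg A)
  have "quant_step\<^sup>*\<^sup>* (plug (comp_ctxt C (CNeg Hole)) (stage L (Suc k) (\<not> pos) us \<rho> A))
    (plug (comp_ctxt C (CNeg Hole)) (stage L k (\<not> pos) us \<rho> A))"
    using Neg.prems by (intro Neg.IH) (auto simp: accessible_comp positive_comp fv_comp)
  then show ?case by (simp add: plug_comp)
next
  case (Bin c A1 A2)
  have sib1: "SVar y ws \<notin> fv (stage L k' pos us \<rho> A2)"
    if "(y, ws) \<in> delta_nodes L pos us A1" "k' \<le> 2 * size_list size ws + 2" for y ws k'
  proof (rule stage_avoids[OF that(2)])
    from delta_nodes_path[OF that(1)] have y: "y \<in> set (binders A1)"
      and ws: "size_list size us \<le> size_list size ws" by auto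
    show "SVar y ws \<notin> fv_trm (\<rho> v)" if "v \<in> fv A2" for v
      using Bin.prems(6)[of v y ws] y ws that by auto
    show "(y, ws) \<notin> delta_nodes L pos us A2"
      using delta_nodes_path[of y ws L pos us A2] y Bin.prems(3) by auto
  qed
  have sib2: "SVar y ws \<notin> fv (stage L k' pos us \<rho> A1)"
    if "(y, ws) \<in> delta_nodes L pos us A2" "k' \<le> 2 * size_list size ws + 2" for y ws k'
  proof (rule stage_avoids[OF that(2)])
    from delta_nodes_path[OF that(1)] have y: "y \<in> set (binders A2)"
      and ws: "size_list size us \<le> size_list size ws" by auto
    show "SVar y ws \<notin> fv_trm (\<rho> v)" if "v \<in> fv A1" for v
      using Bin.prems(6)[of v y ws] y ws that by auto
    show "(y, ws) \<notin> delta_nodes L pos us A1"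
      using delta_nodes_path[of y ws L pos us A1] y Bin.prems(3) by auto
  qed
  let ?C1 = "comp_ctxt C (CBinL c Hole (stage L (Suc k) pos us \<rho> A2))"
  have "quant_step\<^sup>*\<^sup>* (plug ?C1 (stage L (Suc k) pos us \<rho> A1)) (plug ?C1 (stage L k pos us \<rho> A1))"
  proof (rule Bin.IH(1))
    show "size_list size ws < size_list size us"
      if "v \<in> fv A1" "y \<in> set (binders A1)" "SVar y ws \<in> fv_trm (\<rho> v)" for v y ws
      using Bin.prems(6)[of v y ws] that by simp
    show "SVar y ws \<notin> fv_ctxt ?C1"
      if "(y, ws) \<in> delta_nodes L pos us A1" "k = 2 * size_list size ws + 1" for y ws
      using sib1[OF that(1), of "Suc k"] Bin.prems(7)[of y ws] Bin.prems(1) that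
      by (auto simp: fv_comp)
  qed (use Bin.prems(1-5) in \<open>auto simp: accessible_comp positive_comp\<close>)
  moreover
  let ?C2 = "comp_ctxt C (CBinR c (stage L k pos us \<rho> A1) Hole)"
  have "quant_step\<^sup>*\<^sup>* (plug ?C2 (stage L (Suc k) pos us \<rho> A2)) (plug ?C2 (stage L k pos us \<rho> A2))"
  proof (rule Bin.IH(2))
    show "size_list size ws < size_list size us"
      if "v \<in> fv A2" "y \<in> set (binders A2)" "SVar y ws \<in> fv_trm (\<rho> v)" for v y ws
      using Bin.prems(6)[of v y ws] that by simp
    show "SVar y ws \<notin> fv_ctxt ?C2"
      if "(y, ws) \<in> delta_nodes L pos us A2" "k = 2 * size_list size ws + 1" for y ws
      using sib2[OF that(1), of k] Bin.prems(7)[of y ws] Bin.prems(1) that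
      by (auto simp: fv_comp)
  qed (use Bin.prems(1-5) in \<open>auto simp: accessible_comp positive_comp\<close>)
  ultimately show ?case by (simp add: plug_comp)
next
  case (Qu q x A)
  let ?G = "Qu q (OVar x) (copies L pos (\<rho>(x := Var (OVar x))) A)"
  have x: "x \<notin> set (binders A)" using Qu.prems(3) by simp
  have Ofresh: "OVar x \<notin> fv_trm (\<rho> v)" if "v \<in> fv A - {x}" for v
    using Qu.prems(5)[of v x] that by simp
  show ?case
  proof (cases "is_gamma pos q")
    case gamma: True
    define m where "m k t = (if k \<le> 2 * size_list size (us @ [t]) then ?G
      else stage L k pos (us @ [t]) (\<rho>(x := read_trm t)) A)" for k t
    have tfresh: "OVar z \<notin> fv_trm (read_trm t)" if "t \<in> set (L x)" "z \<in> set (binders A)" for t z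
      using L_fresh[OF that(1)] fv_read_OVar[of z t] Qu.prems(4) that(2) by auto
    have sib: "SVar y ws \<notin> fv (m k' t')"
      if nd: "(y, ws) \<in> delta_nodes L pos (us @ [t]) A" and t': "t' \<noteq> t"
        and k': "k' \<le> 2 * size_list size ws + 2" for y ws t t' k'
    proof -
      from delta_nodes_path[OF nd] obtain vs where y: "y \<in> set (binders A)"
        and vs: "ws = us @ [t] @ vs" by auto
      have old: "SVar y ws \<notin> fv_trm (\<rho> v)" if "v \<in> fv A - {x}" for v
        using Qu.prems(6)[of v y ws] that y vs by auto
      then have "SVar y ws \<notin> fv ?G"
        using fv_copies[of pos "\<rho>(x := Var (OVar x))" A] by (fastforce split: if_splits)
      moreover have "SVar y ws \<notin> fv (stage L k' pos (us @ [t']) (\<rho>(x := read_trm t')) A)"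
        if "\<not> k' \<le> 2 * size_list size (us @ [t'])"
      proof (rule stage_avoids[OF k'])
        have "SVar y ws \<notin> fv_trm (read_trm t')"
          using fv_read_SVar[of y ws t'] that k' by auto
        then show "SVar y ws \<notin> fv_trm ((\<rho>(x := read_trm t')) v)" if "v \<in> fv A" for v
          using old that by auto
        show "(y, ws) \<notin> delta_nodes L pos (us @ [t']) A"
          using delta_nodes_path[of y ws L pos "us @ [t']" A] vs t' by auto
      qed
      ultimately show ?thesis by (simp add: m_def)
    qed
    have "quant_step\<^sup>*\<^sup>* (plug C (big (conn_of q) (map (m (Suc k)) (L x))))
       (plug C (big (conn_of q) (map (m k) (L x))))"
    proof (rule replace_members)
      fix as t bs assume split: "L x = as @ t # bs"
      then have t: "t \<in> set (L x)" by simp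
      obtain D where D: "accessible D" "positive D"
        "fv_ctxt D = \<Union> (fv ` (set (map (m k) as) \<union> set (map (m (Suc k)) bs)))"
        and plugD: "\<And>G. plug D G = big (conn_of q) (map (m k) as @ G # map (m (Suc k)) bs)"
        using big_context by metis
      let ?C = "comp_ctxt C D"
      have C: "accessible ?C" "positive ?C = pos"
        using Qu.prems(1,2) D by (auto simp: accessible_comp positive_comp)
      \<comment> \<open>The node of \<open>t\<close> was introduced before, is due now, or stays pending.\<close>
      consider "Suc k \<le> 2 * size_list size (us @ [t])" | "k = 2 * size_list size (us @ [t])"
        | "k > 2 * size_list size (us @ [t])" by linarith
      then have "quant_step\<^sup>*\<^sup>* (plug ?C (m (Suc k) t)) (plug ?C (m k t))"
      proof cases
        case 1
        then show ?thesis by (simp add: m_def)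
      next
        case 2
        have "quant_step (plug ?C (copies L pos (\<rho>(x := read_trm t)) A)) (plug ?C ?G)"
          using C gamma x Ofresh tfresh[OF t] by (intro gamma_step) auto
        moreover have "m (Suc k) t = copies L pos (\<rho>(x := read_trm t)) A"
          using 2 stage_eq_copies[of "Suc k" "us @ [t]"] by (simp add: m_def)
        moreover have "m k t = ?G" using 2 by (simp add: m_def)
        ultimately show ?thesis by simp
      next
        case 3
        have "quant_step\<^sup>*\<^sup>* (plug ?C (stage L (Suc k) pos (us @ [t]) (\<rho>(x := read_trm t)) A))
           (plug ?C (stage L k pos (us @ [t]) (\<rho>(x := read_trm t)) A))"
        proof (rule Qu.IH[OF C])
          show "OVar z \<notin> fv_trm ((\<rho>(x := read_trm t)) v)"
            if "v \<in> fv A" "z \<in> set (binders A)" for v z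
            using Qu.prems(5)[of v z] tfresh[OF t that(2)] that by auto
          show "size_list size ws < size_list size (us @ [t])"
            if "v \<in> fv A" "y \<in> set (binders A)" "SVar y ws \<in> fv_trm ((\<rho>(x := read_trm t)) v)" for v y ws
            using Qu.prems(6)[of v y ws] that fv_read_SVar[of y ws t] by (auto split: if_splits)
          show "SVar y ws \<notin> fv_ctxt ?C"
            if nd: "(y, ws) \<in> delta_nodes L pos (us @ [t]) A" and k: "k = 2 * size_list size ws + 1"
            for y ws
          proof -
            have dist: "distinct (as @ t # bs)" using L_distinct[of x] split by simp
            have "SVar y ws \<notin> fv_ctxt C" using Qu.prems(7)[of y ws] nd k gamma t by auto
            moreover have "SVar y ws \<notin> fv (m k t')" if "t' \<in> set as" for t'
              using dist k that by (intro sib[OF nd]) auto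
            moreover have "SVar y ws \<notin> fv (m (Suc k) t')" if "t' \<in> set bs" for t'
              using dist k that by (intro sib[OF nd]) auto
            ultimately show ?thesis using Qu.prems(1) D(3) by (auto simp: fv_comp)
          qed
        qed (use Qu.prems(3,4) in auto)
        then show ?thesis using 3 by (simp add: m_def)
      qed
      then show "quant_step\<^sup>*\<^sup>*
          (plug C (big (conn_of q) (map (m k) as @ m (Suc k) t # map (m (Suc k)) bs)))
          (plug C (big (conn_of q) (map (m k) as @ m k t # map (m (Suc k)) bs)))"
        unfolding plug_comp plugD .
    qed
    then show ?thesis using gamma by (simp add: Let_def m_def[abs_def])
  next
    case delta: False
    \<comment> \<open>Inner \<open>\<delta>\<close>-nodes of the same weight are introduced here, before the outer one in the second case
      below.\<close>
    have rec: "quant_step\<^sup>*\<^sup>* (plug C (stage L (Suc k) pos us (\<rho>(x := Var (SVar x us))) A))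
       (plug C (stage L k pos us (\<rho>(x := Var (SVar x us))) A))"
    proof (rule Qu.IH[OF Qu.prems(1,2)])
      show "size_list size ws < size_list size us"
        if "v \<in> fv A" "y \<in> set (binders A)" "SVar y ws \<in> fv_trm ((\<rho>(x := Var (SVar x us))) v)"
        for v y ws
        using Qu.prems(6)[of v y ws] that x by (auto split: if_splits)
    qed (use Qu.prems(3-5,7) delta in auto)
    consider "Suc k \<le> 2 * size_list size us + 1" | "k = 2 * size_list size us + 1"
      | "k > 2 * size_list size us + 1" by linarith
    then show ?thesis
    proof cases
      case 1
      then show ?thesis using delta by (simp add: Let_def)
    next
      case 2
      have "quant_step (plug C (copies L pos (\<rho>(x := Var (SVar x us))) A)) (plug C ?G)"
      proof (rule delta_step)
        show "SVar x us \<notin> fv_ctxt C" using Qu.prems(7)[of x us] delta 2 by auto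
        show "SVar x us \<notin> fv_trm (\<rho> v)" if "v \<in> fv A - {x}" for v
          using Qu.prems(6)[of v x us] that by auto
      qed (use Qu.prems(1,2) delta x Ofresh in auto)
      moreover have "stage L k pos us (\<rho>(x := Var (SVar x us))) A = copies L pos (\<rho>(x := Var (SVar x us))) A"
        using 2 by (intro stage_eq_copies) simp
      ultimately have "quant_step\<^sup>*\<^sup>* (plug C (stage L (Suc k) pos us (\<rho>(x := Var (SVar x us))) A)) (plug C ?G)"
        using rec by (auto intro: rtranclp.rtrancl_into_rtrancl)
      then show ?thesis using delta 2 by (simp add: Let_def)
    next
      case 3
      then show ?thesis using rec delta by (simp add: Let_def)
    qed
  qed
qed

lemma stage_eventually_instances:
  "\<exists>K. \<forall>k\<ge>K. stage L k pos us (\<lambda>v. read_trm (\<sigma> v)) A = read_fm (instances L pos us \<sigma> A)"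
proof (induction A arbitrary: pos us \<sigma>)
  case (Atom p ts)
  show ?case by (simp add: read_trm_inst)
next
  case (Neg A)
  show ?case using Neg[of "\<not> pos" us \<sigma>] by auto
next
  case (Bin c A B)
  from Bin(1)[of pos us \<sigma>] Bin(2)[of pos us \<sigma>] obtain K1 K2 where
    "\<forall>k\<ge>K1. stage L k pos us (\<lambda>v. read_trm (\<sigma> v)) A = read_fm (instances L pos us \<sigma> A)"
    "\<forall>k\<ge>K2. stage L k pos us (\<lambda>v. read_trm (\<sigma> v)) B = read_fm (instances L pos us \<sigma> B)" by blast
  then show ?case by (intro exI[of _ "max K1 K2"]) auto
next
  case (Qu q x A)
  have IH: "\<exists>K. \<forall>k\<ge>K. stage L k pos vs ((\<lambda>v. read_trm (\<sigma> v))(x := read_trm t)) A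
      = read_fm (instances L pos vs (\<sigma>(x := t)) A)" for vs t
    using Qu[of pos vs "\<sigma>(x := t)"] unfolding comp_fun_upd[of read_trm] .
  show ?case
  proof (cases "is_gamma pos q")
    case True
    from IH have "\<forall>t. \<exists>K. \<forall>k\<ge>K.
        stage L k pos (us @ [t]) ((\<lambda>v. read_trm (\<sigma> v))(x := read_trm t)) A
        = read_fm (instances L pos (us @ [t]) (\<sigma>(x := t)) A)" by blast
    then obtain K where K: "\<And>t k. k \<ge> K t \<Longrightarrow>
        stage L k pos (us @ [t]) ((\<lambda>v. read_trm (\<sigma> v))(x := read_trm t)) A
        = read_fm (instances L pos (us @ [t]) (\<sigma>(x := t)) A)"
      unfolding choice_iff by blast
    \<comment> \<open>The sum over the row is a convenient common upper bound of the bounds for its members.\<close>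
    define b where "b t = K t + 2 * size_list size (us @ [t]) + 1" for t
    have b: "K t \<le> k" "\<not> k \<le> 2 * size_list size (us @ [t])"
      if "t \<in> set (L x)" "k \<ge> sum_list (map b (L x))" for t k
    proof -
      have "b t \<le> sum_list (map b (L x))" using that(1) by (intro member_le_sum_list) auto
      then show "K t \<le> k" "\<not> k \<le> 2 * size_list size (us @ [t])"
        using that(2) unfolding b_def[of t] by linarith+
    qed
    have "stage L k pos us (\<lambda>v. read_trm (\<sigma> v)) (Qu q x A) = read_fm (instances L pos us \<sigma> (Qu q x A))"
      if k: "k \<ge> sum_list (map b (L x))" for k
    proof -
      have members: "map (\<lambda>t. if k \<le> 2 * size_list size (us @ [t]) then G
             else stage L k pos (us @ [t]) ((\<lambda>v. read_trm (\<sigma> v))(x := read_trm t)) A) (L x)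
          = map (\<lambda>t. read_fm (instances L pos (us @ [t]) (\<sigma>(x := t)) A)) (L x)" for G
      proof (rule map_cong[OF refl])
        fix t assume t: "t \<in> set (L x)"
        show "(if k \<le> 2 * size_list size (us @ [t]) then G
             else stage L k pos (us @ [t]) ((\<lambda>v. read_trm (\<sigma> v))(x := read_trm t)) A)
          = read_fm (instances L pos (us @ [t]) (\<sigma>(x := t)) A)"
          unfolding if_not_P[OF b(2)[OF t k]] by (rule K[OF b(1)[OF t k]])
      qed
      show ?thesis
        unfolding stage.simps instances.simps Let_def if_P[OF True] members
        using L_nonempty[of x] by (simp add: read_big comp_def del: fun_upd_apply)
    qed
    then show ?thesis by blast
  next
    case False
    have "\<exists>K. \<forall>k\<ge>K. stage L k pos us ((\<lambda>v. read_trm (\<sigma> v))(x := Var (SVar x us))) A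
        = read_fm (instances L pos us (\<sigma>(x := Fn (Sk x) us)) A)"
      using IH[of us "Fn (Sk x) us"] by (simp del: fun_upd_apply)
    then obtain K where
      K: "stage L k pos us ((\<lambda>v. read_trm (\<sigma> v))(x := Var (SVar x us))) A
        = read_fm (instances L pos us (\<sigma>(x := Fn (Sk x) us)) A)" if "k \<ge> K" for k
      by blast
    have "stage L k pos us (\<lambda>v. read_trm (\<sigma> v)) (Qu q x A) = read_fm (instances L pos us \<sigma> (Qu q x A))"
      if "k \<ge> K + 2 * size_list size us + 2" for k
      using K[of k] that False by (simp add: Let_def del: fun_upd_apply)
    then show ?thesis by blast
  qed
qed

lemma quantify_instances:
  assumes "distinct (binders A)" "set (binders A) \<subseteq> X" "fv A \<inter> set (binders A) = {}"
  shows "quant_step\<^sup>*\<^sup>* (read_fm (instances L True [] Var A)) (copies L True (\<lambda>v. Var (OVar v)) A)"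
proof -
  have step: "quant_step\<^sup>*\<^sup>* (stage L (Suc k) True [] (\<lambda>v. Var (OVar v)) A)
      (stage L k True [] (\<lambda>v. Var (OVar v)) A)" for k
  proof -
    have "quant_step\<^sup>*\<^sup>* (plug Hole (stage L (Suc k) True [] (\<lambda>v. Var (OVar v)) A))
        (plug Hole (stage L k True [] (\<lambda>v. Var (OVar v)) A))"
      by (rule stage_step) (use assms in auto)
    then show ?thesis by simp
  qed
  have down: "quant_step\<^sup>*\<^sup>* (stage L k True [] (\<lambda>v. Var (OVar v)) A)
      (stage L 0 True [] (\<lambda>v. Var (OVar v)) A)" for k
  proof (induction k)
    case (Suc k)
    show ?case using step[of k] Suc by (rule rtranclp_trans)
  qed (rule rtranclp.rtrancl_refl)
  obtain K where K: "\<forall>k\<ge>K. stage L k True [] (\<lambda>v. read_trm (Var v)) A = read_fm (instances L True [] Var A)"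
    using stage_eventually_instances[of True "[]" Var A] by (elim exE)
  have "read_fm (instances L True [] Var A) = stage L K True [] (\<lambda>v. Var (OVar v)) A"
    using K[rule_format, of K] by simp
  moreover have "copies L True (\<lambda>v. Var (OVar v)) A = stage L 0 True [] (\<lambda>v. Var (OVar v)) A"
    by (simp add: stage_eq_copies)
  ultimately show ?thesis using down[of K] by simp
qed

section \<open>Merging the copies\<close>

lemma merge_copies:
  assumes "is_gamma (positive C) q"
  shows "gamma_simplification\<^sup>*\<^sup>* (plug C (big (conn_of q) (replicate (Suc n) (Qu q x G)))) (plug C (Qu q x G))"
  using assms
proof (induction n arbitrary: C)
  case (Suc n)
  let ?H = "Qu q x G"
  have c: "conn_of q = (if positive C then Or else And)"
    using Suc.prems by (auto simp: is_gamma_def)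
  let ?C = "comp_ctxt C (CBinR (conn_of q) ?H Hole)"
  have "gamma_simplification\<^sup>*\<^sup>* (plug ?C (big (conn_of q) (replicate (Suc n) ?H))) (plug ?C ?H)"
    using Suc.prems by (intro Suc.IH) (simp add: positive_comp)
  then have "gamma_simplification\<^sup>*\<^sup>* (plug C (big (conn_of q) (replicate (Suc (Suc n)) ?H)))
      (plug C (Bin (conn_of q) ?H ?H))"
    by (simp add: plug_comp big_Cons)
  moreover have "simplification C ?H (plug C (Bin (conn_of q) ?H ?H)) (plug C ?H)"
    unfolding c by (rule simplification.intros) (simp add: variant_def)
  then have "gamma_simplification (plug C (Bin (conn_of q) ?H ?H)) (plug C ?H)"
    by (rule gamma_simplification.intros[OF Suc.prems])
  ultimately show ?case by (rule rtranclp.rtrancl_into_rtrancl)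
qed simp

text \<open>Outer rows are merged first, so that the inner rows have to be merged in a single copy
  only.\<close>

lemma simplify_copies:
  "gamma_simplification\<^sup>*\<^sup>* (plug C (copies L (positive C) (\<lambda>v. Var (OVar v)) A))
     (plug C (read_fm (map_fm Fun id id A)))"
proof (induction A arbitrary: C)
  case (Atom p ts)
  have "(inst (\<lambda>v. Var (OVar v)) :: ('f, 'v) trm \<Rightarrow> ('f, 'v) dtrm) = read_trm \<circ> map_trm Fun id"
    by (rule ext) (simp add: read_trm_inst flip: inst_Var)
  then show ?case by (simp add: id_def comp_def)
next
  case (Neg A)
  show ?case using Neg[of "comp_ctxt C (CNeg Hole)"] by (simp add: plug_comp positive_comp id_def)
next
  case (Bin c A B)
  have "gamma_simplification\<^sup>*\<^sup>* (plug C (copies L (positive C) (\<lambda>v. Var (OVar v)) (Bin c A B)))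
      (plug C (Bin c (read_fm (map_fm Fun id id A)) (copies L (positive C) (\<lambda>v. Var (OVar v)) B)))"
    using Bin(1)[of "comp_ctxt C (CBinL c Hole (copies L (positive C) (\<lambda>v. Var (OVar v)) B))"]
    by (simp add: plug_comp positive_comp id_def)
  also have "gamma_simplification\<^sup>*\<^sup>* \<dots> (plug C (read_fm (map_fm Fun id id (Bin c A B))))"
    using Bin(2)[of "comp_ctxt C (CBinR c (read_fm (map_fm Fun id id A)) Hole)"]
    by (simp add: plug_comp positive_comp id_def)
  finally show ?case .
next
  case (Qu q x A)
  let ?G = "copies L (positive C) (\<lambda>v. Var (OVar v)) A"
  have G: "copies L (positive C) ((\<lambda>v. Var (OVar v))(x := Var (OVar x))) A = ?G"
    by (rule arg_cong[of _ _ "\<lambda>\<rho>. copies L (positive C) \<rho> A"]) auto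
  obtain n where n: "length (L x) = Suc n" using L_nonempty[of x] by (cases "L x") auto
  have "gamma_simplification\<^sup>*\<^sup>* (plug C (copies L (positive C) (\<lambda>v. Var (OVar v)) (Qu q x A)))
      (plug C (Qu q (OVar x) ?G))"
    using merge_copies[of C q n "OVar x" ?G] by (auto simp: Let_def G map_replicate_const n)
  also have "gamma_simplification\<^sup>*\<^sup>* \<dots> (plug C (read_fm (map_fm Fun id id (Qu q x A))))"
    using Qu[of "comp_ctxt C (CQu q (OVar x) Hole)"] by (simp add: plug_comp positive_comp id_def)
  finally show ?case .
qed

end

section \<open>The expansion as a sub-expansion\<close>

lemma finite_fv_trm: "finite (fv_trm t)"
  by (induction t) auto

lemma finite_fv: "finite (fv F)"
  by (induction F) (auto simp: finite_fv_trm)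

lemma finite_funs_trm: "finite (funs_trm t)"
  by (induction t) auto

lemma finite_funs: "finite (funs F)"
  by (induction F) (auto simp: finite_funs_trm)

text \<open>Symbols carry their arity in \<open>S\<close>, so there are only finitely many argument lists over the
  terms of smaller height.\<close>

lemma finite_terms_of_bounded_height:
  assumes "finite V" "finite S"
  shows "finite {t. height t < n \<and> fv_trm t \<subseteq> V \<and> funs_trm t \<subseteq> S}" (is "finite (?T n)")
proof (induction n)
  case (Suc n)
  let ?args = "\<lambda>m. {ts. set ts \<subseteq> ?T n \<and> length ts = m}"
  let ?U = "Var ` V \<union> (\<Union>p\<in>S. Fn (fst p) ` ?args (snd p))"
  have "?T (Suc n) \<subseteq> ?U"
  proof
    fix t assume t: "t \<in> ?T (Suc n)"
    show "t \<in> ?U"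
    proof (cases t)
      case (Var x)
      then show ?thesis using t by auto
    next
      case (Fn f ts)
      have "s \<in> ?T n" if "s \<in> set ts" for s
      proof -
        have "height s \<le> Max (insert 0 (set (map height ts)))" using that by (intro Max_ge) auto
        then show ?thesis using t Fn that by auto
      qed
      then have "ts \<in> ?args (length ts)" by blast
      moreover have "(f, length ts) \<in> S" using t Fn by auto
      ultimately show ?thesis unfolding Fn by (intro UnI2 UN_I[of "(f, length ts)"]) simp_all
    qed
  qed
  moreover have "finite ?U"
    by (intro finite_UnI finite_UN_I finite_imageI assms finite_lists_length_eq[OF Suc])
  ultimately show ?case by (rule finite_subset)
qed simp

lemma finite_terms_below: "finite (terms_below n F)"
  unfolding terms_below_def
  by (rule finite_terms_of_bounded_height) (auto simp: finite_fv finite_funs)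

text \<open>Finiteness matters because \<^const>\<open>enumeration\<close> is arbitrary on infinite sets.\<close>

lemma sub_expansion_expansion:
  assumes "finite T" "T \<noteq> {}"
  shows "sub_expansion T F (expansion T F)"
proof -
  have "distinct (enumeration T) \<and> set (enumeration T) = T"
    unfolding enumeration_def
    by (rule someI_ex) (use finite_distinct_list[OF assms(1)] in blast)
  then show ?thesis
    using assms(2)
    by (induction F) (auto simp: quantifier_free_def intro!: sub_expansion.intros)
qed

lemma expansion_quantifier_free: "quantifier_free F \<Longrightarrow> expansion T F = F"
  by (induction F) (auto simp: quantifier_free_def)

section \<open>The derivation\<close>

text \<open>The terms may contain free variables of the Skolemized formula only. These are free in \<open>A\<close>, so by
  rectification they cannot be captured when the quantifiers return.\<close>

lemma derivation_from_sub_expansion: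
  assumes "rectified A" "\<forall>t\<in>T. fv_trm t \<subseteq> fv (outer_skolemized A)"
    and "sub_expansion T (outer_skolemized A) B"
  shows "derivation_from B A"
proof -
  have rect: "fv A \<inter> set (binders A) = {}" "distinct (binders A)"
    using assms(1) by (auto simp: rectified_def)
  have F: "outer_skolemized A = sk_inst True [] Var A"
    unfolding outer_skolemized_def using rect by (simp add: skolemize_eq_sk_inst)
  then have "fv (outer_skolemized A) \<subseteq> fv A" using fv_sk_inst[of True "[]" Var A] by auto
  then have T: "\<forall>t\<in>T. fv_trm t \<inter> set (binders A) = {}" using assms(2) rect by blast
  have "\<exists>L. admissible (set (binders A)) L \<and> B = instances L True (map Var []) Var A"
    using assms(3) rect unfolding F by (intro sub_expansion_instances[OF T]) auto
  then obtain L where L: "admissible (set (binders A)) L" "B = instances L True [] Var A" by auto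
  show ?thesis
    unfolding derivation_from_def quant_step_def[symmetric]
    using quantify_instances[OF L(1) rect(2) order_refl rect(1)] simplify_copies[OF L(1), of Hole A] L(2)
    by auto
qed

theorem lemma5p3:
  fixes A :: "('f, 'p, 'v) fm"
    and F :: "(('f, 'v) fsym, 'p, 'v) fm"
    and n :: nat
  assumes "rectified A"
    and "F = outer_skolemized A"
    and "n > 0"
    and "property_C n A"
  shows "sentential_tautology (expansion (terms_below n F) F) \<and>
         derivation_from (expansion (terms_below n F) F) A \<and>
         (\<forall>B. sub_expansion (terms_below n F) F B \<and> sentential_tautology B \<longrightarrow>
              derivation_from B A)"
proof -
  let ?T = "terms_below n F"
  have C: "expansion_defined ?T F" "sentential_tautology (expansion ?T F)"
    using assms(2,4) by (auto simp: property_C_def Let_def)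
  have "sub_expansion ?T F (expansion ?T F)"
  proof (cases "?T = {}")
    case True
    then have "quantifier_free F" using C(1) by (simp add: expansion_defined_def)
    then show ?thesis by (simp add: expansion_quantifier_free sub_expansion.intros(1))
  next
    case False
    then show ?thesis by (intro sub_expansion_expansion finite_terms_below)
  qed
  moreover have "derivation_from B A" if "sub_expansion ?T F B" for B
    using assms(1,2) that by (intro derivation_from_sub_expansion) (auto simp: terms_below_def)
  ultimately show ?thesis using C(2) by blast
qed

end
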